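(* Let $G$ be an infinite finitely generated word hyperbolic group which does not have a finite index subgroup isomorphic to $\mathbb{Z}$, and let $S$ be a finite generating set of $G$. If $(G,d_S)$ admits a bilipschitz embedding into a Banach space $X$, then $X$ is nonsuperreflexive.
   Context: A Banach space is superreflexive if it admits an equivalent uniformly convex norm; otherwise it is nonsuperreflexive. $d_S$ denotes the word metric (shortest path metric of the Cayley graph with respect to $S$). Word hyperbolic is in the sense of Gromov. A bilipschitz embedding is a map $f$ with $c\,d(u,v)\le \|f(u)-f(v)\|\le C\,d(u,v)$ for some constants $0<c\le C<\infty$. *)

theory Defs
  imports "HOL-Analysis.Analysis" "HOL-Algebra.Algebra"
begin

definition word_length :: "('a, 'b) monoid_scheme \<Rightarrow> 'a set \<Rightarrow> 'a \<Rightarrow> nat" where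
  "word_length G S g =
     (LEAST n. \<exists>ws. length ws = n \<and> set ws \<subseteq> S \<union> (m_inv G ` S) \<and>
                    foldr (mult G) ws (one G) = g)"

definition word_metric :: "('a, 'b) monoid_scheme \<Rightarrow> 'a set \<Rightarrow> 'a \<Rightarrow> 'a \<Rightarrow> real" where
  "word_metric G S g h = real (word_length G S (m_inv G g \<otimes>\<^bsub>G\<^esub> h))"

definition finite_generating_set :: "('a, 'b) monoid_scheme \<Rightarrow> 'a set \<Rightarrow> bool" where
  "finite_generating_set G S \<longleftrightarrow> finite S \<and> S \<subseteq> carrier G \<and> generate G S = carrier G"

definition finitely_generated_group :: "('a, 'b) monoid_scheme \<Rightarrow> bool" where
  "finitely_generated_group G \<longleftrightarrow> group G \<and> (\<exists>S. finite_generating_set G S)"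

definition gromov_product :: "('p \<Rightarrow> 'p \<Rightarrow> real) \<Rightarrow> 'p \<Rightarrow> 'p \<Rightarrow> 'p \<Rightarrow> real" where
  "gromov_product d w x y = (d x w + d y w - d x y) / 2"

definition delta_hyperbolic :: "'p set \<Rightarrow> ('p \<Rightarrow> 'p \<Rightarrow> real) \<Rightarrow> real \<Rightarrow> bool" where
  "delta_hyperbolic A d \<delta> \<longleftrightarrow>
     (\<forall>w\<in>A. \<forall>x\<in>A. \<forall>y\<in>A. \<forall>z\<in>A.
        gromov_product d w x z \<ge> min (gromov_product d w x y) (gromov_product d w y z) - \<delta>)"

definition word_hyperbolic :: "('a, 'b) monoid_scheme \<Rightarrow> bool" where
  "word_hyperbolic G \<longleftrightarrow> finitely_generated_group G \<and>
     (\<exists>S \<delta>. finite_generating_set G S \<and> delta_hyperbolic (carrier G) (word_metric G S) \<delta>)"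

definition has_finite_index_subgroup_iso_Z :: "('a, 'b) monoid_scheme \<Rightarrow> bool" where
  "has_finite_index_subgroup_iso_Z G \<longleftrightarrow>
     (\<exists>H. subgroup H G \<and> finite (rcosets\<^bsub>G\<^esub> H) \<and> G\<lparr>carrier := H\<rparr> \<cong> integer_group)"

definition bilipschitz_embedding ::
  "'p set \<Rightarrow> ('p \<Rightarrow> 'p \<Rightarrow> real) \<Rightarrow> ('p \<Rightarrow> 'v::real_normed_vector) \<Rightarrow> bool" where
  "bilipschitz_embedding A d f \<longleftrightarrow>
     (\<exists>c C. 0 < c \<and> c \<le> C \<and>
        (\<forall>u\<in>A. \<forall>v\<in>A. c * d u v \<le> norm (f u - f v) \<and> norm (f u - f v) \<le> C * d u v))"

definition is_norm :: "('v::real_vector \<Rightarrow> real) \<Rightarrow> bool" where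
  "is_norm N \<longleftrightarrow> (\<forall>x. 0 \<le> N x) \<and> (\<forall>x. N x = 0 \<longleftrightarrow> x = 0) \<and>
     (\<forall>x y. N (x + y) \<le> N x + N y) \<and> (\<forall>a x. N (a *\<^sub>R x) = \<bar>a\<bar> * N x)"

definition equivalent_norm :: "('v::real_normed_vector \<Rightarrow> real) \<Rightarrow> bool" where
  "equivalent_norm N \<longleftrightarrow> is_norm N \<and>
     (\<exists>c C. 0 < c \<and> 0 < C \<and> (\<forall>x. c * norm x \<le> N x \<and> N x \<le> C * norm x))"

definition uniformly_convex_norm :: "('v::real_vector \<Rightarrow> real) \<Rightarrow> bool" where
  "uniformly_convex_norm N \<longleftrightarrow>
     (\<forall>\<epsilon>>0. \<exists>\<delta>>0. \<forall>x y. N x \<le> 1 \<and> N y \<le> 1 \<and> N (x - y) \<ge> \<epsilon> \<longrightarrow>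
        N ((1/2) *\<^sub>R (x + y)) \<le> 1 - \<delta>)"

definition superreflexive :: "'v::banach itself \<Rightarrow> bool" where
  "superreflexive _ \<longleftrightarrow> (\<exists>N::'v \<Rightarrow> real. equivalent_norm N \<and> uniformly_convex_norm N)"

end

theory Submission
  imports Defs
begin

text \<open>
  Suppose first that every triangle in a hyperbolic Cayley graph of \<open>G\<close> is degenerate, in the sense
  that one of its three Gromov products is bounded by a fixed constant. Then \<open>G\<close> is coarsely a line,
  and a long element that coarsely translates this line generates a subgroup isomorphic to \<open>\<int>\<close>
  of finite index. Otherwise there are arbitrarily fat triangles; translating their centres shows
  that every point of \<open>G\<close> is, at every scale, the centre of a tripod whose legs have uniformly
  bounded Gromov products. Given any point, at least two legs of a tripod lead away from it, so
  every segment can be prolonged in two diverging directions. In a uniformly convex space one of the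
  two prolongations loses a fixed factor \<open>q < 1\<close> in length, so after \<open>k\<close> doublings of the scale some
  points are mapped closer by the factor \<open>q ^ k\<close>, against the lower Lipschitz bound.
\<close>

section \<open>Word metrics\<close>

locale finitely_generated = group G for G :: "('a, 'b) monoid_scheme" (structure) +
  fixes S :: "'a set"
  assumes generating: "finite_generating_set G S"
begin

abbreviation letters :: "'a set" where
  "letters \<equiv> S \<union> (m_inv G ` S)"

abbreviation eval_word :: "'a list \<Rightarrow> 'a" where
  "eval_word ws \<equiv> foldr (mult G) ws \<one>"

abbreviation len :: "'a \<Rightarrow> nat" where
  "len \<equiv> word_length G S"

abbreviation d :: "'a \<Rightarrow> 'a \<Rightarrow> real" where
  "d \<equiv> word_metric G S"

lemma mult_inv_cancel:
  assumes "x \<in> carrier G" "y \<in> carrier G"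
  shows "x \<otimes> (inv x \<otimes> y) = y" "inv x \<otimes> (x \<otimes> y) = y"
  using assms m_assoc[of x "inv x" y] m_assoc[of "inv x" x y] by simp_all

lemma letters_carrier: "letters \<subseteq> carrier G"
  using generating by (auto simp: finite_generating_set_def)

lemma finite_letters: "finite letters"
  using generating by (auto simp: finite_generating_set_def)

lemma inv_letters: "x \<in> letters \<Longrightarrow> inv x \<in> letters"
  using generating by (auto simp: finite_generating_set_def subset_iff)

lemma inv_word_letters:
  assumes "set ws \<subseteq> letters"
  shows "set (rev (map (m_inv G) ws)) \<subseteq> letters"
proof
  fix x assume "x \<in> set (rev (map (m_inv G) ws))"
  then obtain y where "y \<in> set ws" "x = inv y" by auto
  then show "x \<in> letters" using assms inv_letters by blast
qed

lemma eval_word_closed: "set ws \<subseteq> letters \<Longrightarrow> eval_word ws \<in> carrier G"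
proof (induction ws)
  case (Cons a ws)
  then have "a \<in> carrier G" "eval_word ws \<in> carrier G" using letters_carrier by auto
  then show ?case by simp
qed simp

lemma eval_word_append:
  assumes "set xs \<subseteq> letters" "set ys \<subseteq> letters"
  shows "eval_word (xs @ ys) = eval_word xs \<otimes> eval_word ys"
  using assms(1)
proof (induction xs)
  case Nil
  then show ?case using eval_word_closed[OF assms(2)] by simp
next
  case (Cons a xs)
  then have "a \<in> carrier G" "eval_word xs \<in> carrier G"
    using letters_carrier eval_word_closed[of xs] by auto
  with Cons eval_word_closed[OF assms(2)] show ?case by (simp add: m_assoc)
qed

lemma eval_word_inv:
  "set ws \<subseteq> letters \<Longrightarrow> eval_word (rev (map (m_inv G) ws)) = inv (eval_word ws)"
proof (induction ws)
  case (Cons a ws)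
  have a: "a \<in> carrier G" "inv a \<in> letters" "eval_word ws \<in> carrier G"
    using Cons.prems letters_carrier inv_letters[of a] eval_word_closed[of ws] by auto
  have ws: "set (rev (map (m_inv G) ws)) \<subseteq> letters"
    using Cons.prems inv_word_letters by simp
  have "eval_word (rev (map (m_inv G) (a # ws)))
      = eval_word (rev (map (m_inv G) ws)) \<otimes> eval_word [inv a]"
    using eval_word_append[OF ws, of "[inv a]"] a by simp
  with Cons a show ?case by (simp add: inv_mult_group)
qed simp

lemma word_exists:
  assumes "g \<in> carrier G"
  shows "\<exists>ws. set ws \<subseteq> letters \<and> eval_word ws = g"
proof -
  have "g \<in> generate G S" using assms generating by (simp add: finite_generating_set_def)
  then show ?thesis
  proof (induction rule: generate.induct)
    case one
    show ?case by (rule exI[of _ "[]"]) simp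
  next
    case (incl h)
    then show ?case using letters_carrier by (intro exI[of _ "[h]"]) auto
  next
    case (inv h)
    then have "inv h \<in> letters" by blast
    moreover from this have "inv h \<in> carrier G" by (rule subsetD[OF letters_carrier])
    ultimately show ?case by (intro exI[of _ "[inv h]"]) simp
  next
    case (eng h1 h2)
    then obtain xs ys where "set xs \<subseteq> letters" "eval_word xs = h1"
      "set ys \<subseteq> letters" "eval_word ys = h2" by blast
    then show ?case using eval_word_append[of xs ys] by (intro exI[of _ "xs @ ys"]) simp
  qed
qed

lemma shortest_word:
  assumes "g \<in> carrier G"
  obtains ws where "length ws = len g" "set ws \<subseteq> letters" "eval_word ws = g"
proof -
  have "\<exists>n ws. length ws = n \<and> set ws \<subseteq> letters \<and> eval_word ws = g"
    using word_exists[OF assms] by blast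
  from LeastI_ex[OF this] that show ?thesis unfolding word_length_def by blast
qed

lemma len_le: "set ws \<subseteq> letters \<Longrightarrow> len (eval_word ws) \<le> length ws"
  unfolding word_length_def by (rule Least_le) blast

lemma len_mult:
  assumes "g \<in> carrier G" "h \<in> carrier G"
  shows "len (g \<otimes> h) \<le> len g + len h"
proof -
  obtain xs where xs: "length xs = len g" "set xs \<subseteq> letters" "eval_word xs = g"
    by (rule shortest_word[OF assms(1)])
  obtain ys where ys: "length ys = len h" "set ys \<subseteq> letters" "eval_word ys = h"
    by (rule shortest_word[OF assms(2)])
  from xs ys show ?thesis using len_le[of "xs @ ys"] eval_word_append[of xs ys] by simp
qed

lemma len_one: "len \<one> = 0"
  using len_le[of "[]"] by simp

lemma len_inv:
  assumes "g \<in> carrier G"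
  shows "len (inv g) = len g"
proof -
  have le: "len (inv h) \<le> len h" if "h \<in> carrier G" for h
  proof -
    obtain ws where ws: "length ws = len h" "set ws \<subseteq> letters" "eval_word ws = h"
      by (rule shortest_word[OF \<open>h \<in> carrier G\<close>])
    moreover have "set (rev (map (m_inv G) ws)) \<subseteq> letters" using ws(2) inv_word_letters by blast
    ultimately show ?thesis
      using len_le[of "rev (map (m_inv G) ws)"] eval_word_inv[of ws] by simp
  qed
  from le[of g] le[of "inv g"] assms show ?thesis by simp
qed

lemma finite_ball: "finite {g \<in> carrier G. len g \<le> n}"
proof (rule finite_subset)
  show "{g \<in> carrier G. len g \<le> n} \<subseteq> eval_word ` {ws. set ws \<subseteq> letters \<and> length ws \<le> n}"
  proof
    fix g assume "g \<in> {g \<in> carrier G. len g \<le> n}"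
    then have g: "g \<in> carrier G" "len g \<le> n" by auto
    obtain ws where "length ws = len g" "set ws \<subseteq> letters" "eval_word ws = g"
      by (rule shortest_word[OF g(1)])
    with g(2) show "g \<in> eval_word ` {ws. set ws \<subseteq> letters \<and> length ws \<le> n}"
      by (intro image_eqI[of _ _ ws]) auto
  qed
  show "finite (eval_word ` {ws. set ws \<subseteq> letters \<and> length ws \<le> n})"
    by (intro finite_imageI finite_lists_length_le finite_letters)
qed

lemma d_self: "x \<in> carrier G \<Longrightarrow> d x x = 0"
  by (simp add: word_metric_def len_one)

lemma d_sym:
  assumes "x \<in> carrier G" "y \<in> carrier G"
  shows "d x y = d y x"
  using assms len_inv[of "inv x \<otimes> y"] by (simp add: word_metric_def inv_mult_group)

lemma d_triangle:
  assumes "x \<in> carrier G" "y \<in> carrier G" "z \<in> carrier G"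
  shows "d x z \<le> d x y + d y z"
proof -
  have "inv x \<otimes> z = (inv x \<otimes> y) \<otimes> (inv y \<otimes> z)"
    using assms by (simp add: m_assoc mult_inv_cancel)
  then show ?thesis
    using assms len_mult[of "inv x \<otimes> y" "inv y \<otimes> z"] by (simp add: word_metric_def)
qed

lemma d_translate:
  assumes "g \<in> carrier G" "x \<in> carrier G" "y \<in> carrier G"
  shows "d (g \<otimes> x) (g \<otimes> y) = d x y"
proof -
  have "inv (g \<otimes> x) \<otimes> (g \<otimes> y) = inv x \<otimes> y"
    using assms by (simp add: inv_mult_group m_assoc mult_inv_cancel)
  then show ?thesis by (simp add: word_metric_def)
qed

lemma d_one: "x \<in> carrier G \<Longrightarrow> d \<one> x = len x"
  by (simp add: word_metric_def)

text \<open>Cut a shortest word for \<open>inv x \<otimes> y\<close> after \<open>m\<close> letters.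
  The pieces have length at most \<open>m\<close> and at most the remainder, and their lengths add
  up to at least the whole, so both bounds are attained. This is the discrete form of geodesicity,
  available at integer distances.\<close>

lemma geodesic_point:
  assumes "x \<in> carrier G" "y \<in> carrier G" "real m \<le> d x y"
  obtains p where "p \<in> carrier G" "d x p = m" "d p y = d x y - m"
proof -
  define h where "h = inv x \<otimes> y"
  have h: "h \<in> carrier G" and dh: "d x y = len h"
    using assms by (auto simp: h_def word_metric_def)
  obtain ws where ws: "length ws = len h" "set ws \<subseteq> letters" "eval_word ws = h"
    by (rule shortest_word[OF h])
  define u v where "u = eval_word (take m ws)" and "v = eval_word (drop m ws)"
  have sub: "set (take m ws) \<subseteq> letters" "set (drop m ws) \<subseteq> letters"
    using ws(2) set_take_subset[of m ws] set_drop_subset[of m ws] by auto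
  have uv: "u \<in> carrier G" "v \<in> carrier G" "u \<otimes> v = h"
    unfolding u_def v_def
    using eval_word_closed[OF sub(1)] eval_word_closed[OF sub(2)] eval_word_append[OF sub] ws(3)
    by simp_all
  have "len u \<le> m" "len v \<le> len h - m"
    using len_le[OF sub(1)] len_le[OF sub(2)] ws(1) by (auto simp: u_def v_def)
  moreover have "m \<le> len h" using assms dh by simp
  moreover have "len h \<le> len u + len v" using len_mult[OF uv(1,2)] uv(3) by simp
  ultimately have lens: "len u = m" "len v = len h - m" by linarith+
  have "inv x \<otimes> (x \<otimes> u) = u" using assms uv by (simp add: mult_inv_cancel)
  moreover have "inv (x \<otimes> u) \<otimes> y = v"
  proof -
    have "y = (x \<otimes> u) \<otimes> v" using assms uv by (simp add: m_assoc h_def mult_inv_cancel)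
    then show ?thesis using assms uv mult_inv_cancel(2)[of "x \<otimes> u" v] by simp
  qed
  ultimately show thesis
    using that[of "x \<otimes> u"] assms uv lens dh \<open>m \<le> len h\<close> by (simp add: word_metric_def)
qed

text \<open>Balls are finite, so lengths are unbounded; a prefix of a shortest word for a longer
  element has exactly the prescribed length.\<close>

lemma long_element:
  assumes "infinite (carrier G)"
  obtains g where "g \<in> carrier G" "len g = n"
proof -
  have "\<exists>g \<in> carrier G. n < len g"
  proof (rule ccontr)
    assume "\<not> (\<exists>g \<in> carrier G. n < len g)"
    then have "carrier G \<subseteq> {g \<in> carrier G. len g \<le> n}" by (simp add: subset_iff not_less)
    from finite_subset[OF this finite_ball] assms show False by contradiction
  qed
  then obtain g where g: "g \<in> carrier G" "n < len g" by (rule bexE)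
  then have "real n \<le> d \<one> g" by (simp add: d_one)
  then obtain p where "p \<in> carrier G" "d \<one> p = n"
    by (rule geodesic_point[OF one_closed g(1)])
  then show thesis using that[of p] by (simp add: d_one)
qed

end

text \<open>Hyperbolicity is given for one generating set and the embedding for another. Rewriting
  each of the finitely many letters of \<open>T\<close> as a word in \<open>S\<close> compares the
  two metrics linearly, so the embedding can be transported to the generating set for which
  hyperbolicity is known.\<close>

lemma word_length_le_word_length:
  assumes "group G" "finite_generating_set G S" "finite_generating_set G T"
  obtains A :: nat where "A > 0"
    "\<And>g. g \<in> carrier G \<Longrightarrow> word_length G S g \<le> A * word_length G T g"
proof -
  interpret group G by fact
  interpret S: finitely_generated G S by unfold_locales fact
  interpret T: finitely_generated G T by unfold_locales fact
  \<comment> \<open>\<open>Suc\<close> keeps the constant positive even if every letter is trivial;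
    such a constant is divided by later.\<close>
  define A where "A = Suc (Max (word_length G S ` T.letters))"
  have letter: "word_length G S a \<le> A" if "a \<in> T.letters" for a
    using that T.finite_letters unfolding A_def by (intro le_SucI Max_ge) auto
  have word: "word_length G S (S.eval_word ws) \<le> A * length ws" if "set ws \<subseteq> T.letters" for ws
    using that
  proof (induction ws)
    case Nil
    then show ?case by (simp add: S.len_one)
  next
    case (Cons a ws)
    then have "a \<in> T.letters" "a \<in> carrier G" using T.letters_carrier by auto
    with letter[of a] Cons S.len_mult[of a "S.eval_word ws"] T.eval_word_closed[of ws]
    show ?case by auto
  qed
  show thesis
  proof (rule that)
    show "A > 0" by (simp add: A_def)
    fix g assume "g \<in> carrier G"
    then obtain ws where "length ws = T.len g" "set ws \<subseteq> T.letters" "T.eval_word ws = g"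
      by (rule T.shortest_word)
    then show "word_length G S g \<le> A * word_length G T g" using word[of ws] by simp
  qed
qed

section \<open>Branching spaces and uniform convexity\<close>

text \<open>A bounded product says that \<open>y\<close> is almost between \<open>z i\<close> and
  \<open>z j\<close>, so the three legs leave \<open>y\<close> in different directions. Their
  lengths are tracked separately.\<close>

definition tripod :: "('p \<Rightarrow> 'p \<Rightarrow> real) \<Rightarrow> real \<Rightarrow> 'p \<Rightarrow> (nat \<Rightarrow> 'p) \<Rightarrow> bool" where
  "tripod d R y z \<longleftrightarrow> (\<forall>i<3. \<forall>j<3. i \<noteq> j \<longrightarrow> gromov_product d y (z i) (z j) \<le> R)"

text \<open>At most one leg can follow the way back to \<open>x\<close>: two such legs would, by
  hyperbolicity, have a product exceeding \<open>R\<close> with each other.\<close>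

lemma tripod_two_legs_away:
  assumes "delta_hyperbolic A d \<delta>" "tripod d R y z"
    and sym: "\<And>u v. u \<in> A \<Longrightarrow> v \<in> A \<Longrightarrow> d u v = d v u"
    and "x \<in> A" "y \<in> A" "\<And>i. i < 3 \<Longrightarrow> z i \<in> A"
  obtains i j :: nat where "i < 3" "j < 3" "i \<noteq> j"
    "gromov_product d y x (z i) \<le> R + \<delta>" "gromov_product d y x (z j) \<le> R + \<delta>"
proof -
  define bad where "bad i \<longleftrightarrow> R + \<delta> < gromov_product d y x (z i)" for i
  have "\<not> (bad i \<and> bad j)" if "i < 3" "j < 3" "i \<noteq> j" for i j
  proof -
    have "gromov_product d y (z i) (z j)
        \<ge> min (gromov_product d y (z i) x) (gromov_product d y x (z j)) - \<delta>"
      using assms that by (simp add: delta_hyperbolic_def)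
    moreover have "gromov_product d y (z i) x = gromov_product d y x (z i)"
      using sym[of "z i" x] assms that by (simp add: gromov_product_def)
    moreover have "gromov_product d y (z i) (z j) \<le> R"
      using assms(2) that by (simp add: tripod_def)
    ultimately show ?thesis by (auto simp: bad_def)
  qed
  from this[of 0 1] this[of 0 2] this[of 1 2]
  have "\<not> bad 0 \<and> \<not> bad 1 \<or> \<not> bad 0 \<and> \<not> bad 2 \<or> \<not> bad 1 \<and> \<not> bad 2" by auto
  then show thesis using that[of 0 1] that[of 0 2] that[of 1 2] by (auto simp: bad_def)
qed

text \<open>Rescale by \<open>M\<close> to the unit ball. If \<open>a + c\<close> is longer than
  \<open>2 * q * M\<close>, then \<open>a\<close> and \<open>c\<close> are closer than
  \<open>\<epsilon> * M\<close>. Both \<open>b\<close> and \<open>b'\<close> cannot be that close to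
  \<open>a\<close>, since they are \<open>2 * \<epsilon> * M\<close> apart.\<close>

lemma uniformly_convex_fork:
  fixes N :: "'v::real_vector \<Rightarrow> real"
  assumes N: "is_norm N" and "0 < M"
    and uc: "\<And>x y. N x \<le> 1 \<Longrightarrow> N y \<le> 1 \<Longrightarrow> N (x - y) \<ge> \<epsilon> \<Longrightarrow> N ((1/2) *\<^sub>R (x + y)) \<le> q"
    and "N a \<le> M" "N b \<le> M" "N b' \<le> M" "N (b - b') \<ge> 2 * \<epsilon> * M"
  shows "N (a + b) \<le> 2 * q * M \<or> N (a + b') \<le> 2 * q * M"
proof (rule ccontr)
  have scale: "N (r *\<^sub>R x) = \<bar>r\<bar> * N x" and tri: "N (x + y) \<le> N x + N y" for r x y
    using N by (auto simp: is_norm_def)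
  have close: "N (a - c) < \<epsilon> * M" if "N c \<le> M" "2 * q * M < N (a + c)" for c
  proof (rule ccontr)
    assume "\<not> N (a - c) < \<epsilon> * M"
    then have far: "\<epsilon> \<le> N ((1/M) *\<^sub>R a - (1/M) *\<^sub>R c)"
      using \<open>0 < M\<close> scale[of "1/M" "a - c"] by (simp add: scaleR_diff_right pos_le_divide_eq)
    have "N ((1/M) *\<^sub>R a) \<le> 1" "N ((1/M) *\<^sub>R c) \<le> 1"
      using \<open>0 < M\<close> \<open>N a \<le> M\<close> \<open>N c \<le> M\<close> by (simp_all add: scale field_simps)
    from uc[OF this far] have "N ((1/2) *\<^sub>R (1/M) *\<^sub>R (a + c)) \<le> q"
      by (simp add: scaleR_add_right)
    then have "\<bar>1/2\<bar> * (\<bar>1/M\<bar> * N (a + c)) \<le> q" by (simp only: scale)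
    then show False using \<open>0 < M\<close> that by (simp add: field_simps)
  qed
  assume "\<not> ?thesis"
  then have "N (a - b) < \<epsilon> * M" "N (a - b') < \<epsilon> * M" using close assms by auto
  moreover have "N (b - b') \<le> N (a - b) + N (a - b')"
    using tri[of "(-1) *\<^sub>R (a - b)" "a - b'"] scale[of "-1" "a - b"] by simp
  ultimately show False using assms by simp
qed

text \<open>The fork inequality makes one of any two diverging extensions of a segment shorter than
  the sum of its halves by a fixed factor; doubling the scale \<open>k\<close> times gains the factor \<open>q ^ k\<close>.\<close>

lemma branching_doubling:
  fixes N :: "'v::real_vector \<Rightarrow> real"
  assumes hyp: "delta_hyperbolic A d \<delta>" and "0 \<le> \<delta>"
    and sym: "\<And>u v. u \<in> A \<Longrightarrow> v \<in> A \<Longrightarrow> d u v = d v u"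
    and branch: "\<And>y n. y \<in> A \<Longrightarrow> \<exists>z. z ` {..<3} \<subseteq> A \<and> tripod d R0 y z \<and> (\<forall>i<3. d y (z i) = real n)"
    and N: "is_norm N"
    and "0 < c" "0 < C" "0 < q" "q \<le> 1"
    and bounds: "\<And>u v. u \<in> A \<Longrightarrow> v \<in> A \<Longrightarrow>
      c * d u v \<le> N (f v - f u) \<and> N (f v - f u) \<le> C * d u v"
    and uc: "\<And>x y. N x \<le> 1 \<Longrightarrow> N y \<le> 1 \<Longrightarrow> N (x - y) \<ge> c / (2 * C) \<Longrightarrow>
      N ((1/2) *\<^sub>R (x + y)) \<le> q"
  shows "\<exists>R n0. \<forall>n\<ge>n0. \<forall>y\<in>A. \<exists>z. z ` {..<3} \<subseteq> A \<and> tripod d R y z \<and>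
    (\<forall>i<3. 2 ^ k * real n - R \<le> d y (z i) \<and> N (f (z i) - f y) \<le> q ^ k * C * (2 ^ k * real n))"
proof (induction k)
  case 0
  \<comment> \<open>Before any doubling the upper bound is just the Lipschitz bound;
    \<open>max R0 0\<close> makes the permitted loss of length nonnegative.\<close>
  have "\<exists>z. z ` {..<3} \<subseteq> A \<and> tripod d (max R0 0) y z \<and>
    (\<forall>i<3. 2 ^ 0 * real n - (max R0 0) \<le> d y (z i) \<and> N (f (z i) - f y) \<le> q ^ 0 * C * (2 ^ 0 * real n))"
    if y: "y \<in> A" for n y
  proof -
    from branch[OF y, of n] obtain z where z: "z ` {..<3} \<subseteq> A" "tripod d R0 y z"
      "\<forall>i<3. d y (z i) = real n" by blast
    have "N (f (z i) - f y) \<le> C * real n" if "i < 3" for i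
      using bounds[OF y, of "z i"] z that by (auto simp: image_subset_iff)
    then show ?thesis using z by (intro exI[of _ z]) (auto simp: tripod_def le_max_iff_disj)
  qed
  then show ?case by blast
next
  case (Suc k)
  then obtain R1 n0 where IH: "\<And>n y. n0 \<le> n \<Longrightarrow> y \<in> A \<Longrightarrow> \<exists>z. z ` {..<3} \<subseteq> A \<and> tripod d R1 y z \<and>
    (\<forall>i<3. 2 ^ k * real n - R1 \<le> d y (z i) \<and> N (f (z i) - f y) \<le> q ^ k * C * (2 ^ k * real n))"
    by blast
  define R where "R = \<bar>R1\<bar>"
  have R: "R1 \<le> R" "0 \<le> R" by (auto simp: R_def)
  \<comment> \<open>Two legs of length at least \<open>s - R\<close> are joined with product at most
    \<open>R + \<delta>\<close> at the joint, so the new leg loses at most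
    \<open>2 * R + 2 * (R + \<delta>)\<close>. The threshold \<open>n1\<close> makes the scale
    \<open>s\<close> dominate all these errors.\<close>
  define R' where "R' = 4 * R + 2 * \<delta>"
  define n1 where "n1 = max (max n0 1) (nat \<lceil>6 * R + 4 * \<delta>\<rceil>)"
  have "\<exists>w. w ` {..<3} \<subseteq> A \<and> tripod d R' y w \<and>
    (\<forall>i<3. 2 ^ Suc k * real n - R' \<le> d y (w i) \<and>
       N (f (w i) - f y) \<le> q ^ Suc k * C * (2 ^ Suc k * real n))"
    if n: "n1 \<le> n" and y: "y \<in> A" for n y
  proof -
    define s where "s = 2 ^ k * real n"
    have "n0 \<le> n" "1 \<le> n" using n by (auto simp: n1_def)
    have "6 * R + 4 * \<delta> \<le> real n" using n unfolding n1_def by linarith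
    also have "real n \<le> s" by (simp add: s_def mult_left_le_one_le mult_le_cancel_right1)
    finally have s_large: "6 * R + 4 * \<delta> \<le> s" .
    have "0 < s" using \<open>1 \<le> n\<close> by (simp add: s_def)
    define M where "M = q ^ k * C * s"
    have "0 < M" using \<open>0 < q\<close> \<open>0 < C\<close> \<open>0 < s\<close> by (simp add: M_def)
    have M_le: "M \<le> C * s"
      using \<open>0 < C\<close> \<open>0 < s\<close> \<open>0 < q\<close> \<open>q \<le> 1\<close> power_le_one[of q k] by (simp add: M_def mult.assoc mult_left_le_one_le)
    have step: "\<exists>z. z ` {..<3} \<subseteq> A \<and> tripod d R y z \<and>
      (\<forall>i<3. s - R \<le> d y (z i) \<and> N (f (z i) - f y) \<le> M)" if "y \<in> A" for y
    proof -
      from IH[OF \<open>n0 \<le> n\<close> that] obtain z where "z ` {..<3} \<subseteq> A" "tripod d R1 y z"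
        "\<forall>i<3. s - R1 \<le> d y (z i) \<and> N (f (z i) - f y) \<le> M"
        unfolding M_def s_def by blast
      then show ?thesis using R by (intro exI[of _ z]) (fastforce simp: tripod_def)
    qed
    from step[OF y] obtain z where z: "\<And>i. i < 3 \<Longrightarrow> z i \<in> A" "tripod d R y z"
      "\<And>i. i < 3 \<Longrightarrow> s - R \<le> d y (z i)" "\<And>i. i < 3 \<Longrightarrow> N (f (z i) - f y) \<le> M"
      by (auto simp: image_subset_iff)
    \<comment> \<open>One leg from \<open>y\<close> to \<open>x\<close> is prolonged by a tripod at
      \<open>x\<close>. Two of its legs lead away from \<open>y\<close>, and the fork inequality
      selects one whose image stays close to \<open>f y\<close>.\<close>
    have "\<exists>w. w \<in> A \<and> gromov_product d x y w \<le> R + \<delta> \<and> s - R \<le> d x w \<and>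
        N (f w - f y) \<le> 2 * q * M" if x: "x \<in> A" and xy: "N (f x - f y) \<le> M" for x
    proof -
      from step[OF x] obtain t where t: "\<And>i. i < 3 \<Longrightarrow> t i \<in> A" "tripod d R x t"
        "\<And>i. i < 3 \<Longrightarrow> s - R \<le> d x (t i)" "\<And>i. i < 3 \<Longrightarrow> N (f (t i) - f x) \<le> M"
        by (auto simp: image_subset_iff)
      obtain i j where ij: "i < 3" "j < 3" "i \<noteq> j"
        "gromov_product d x y (t i) \<le> R + \<delta>" "gromov_product d x y (t j) \<le> R + \<delta>"
        using tripod_two_legs_away[OF hyp t(2) sym y x t(1)] by blast
      have "gromov_product d x (t i) (t j) \<le> R" using t(2) ij by (simp add: tripod_def)
      then have "d (t i) x + d (t j) x - d (t i) (t j) \<le> 2 * R" by (simp add: gromov_product_def)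
      moreover have "d (t i) x = d x (t i)" "d (t j) x = d x (t j)" using sym x t ij by auto
      ultimately have "s \<le> d (t i) (t j)" using t(3)[of i] t(3)[of j] ij s_large \<open>0 \<le> \<delta>\<close> R by linarith
      then have "c * s \<le> c * d (t i) (t j)" using \<open>0 < c\<close> by simp
      also have "\<dots> \<le> N (f (t j) - f (t i))" using bounds t ij by blast
      finally have "c * s \<le> N (f (t j) - f (t i))" .
      \<comment> \<open>Here the convexity parameter \<open>c / (2 * C)\<close> is explained: since
        \<open>M\<close> is at most \<open>C * s\<close>, the lower Lipschitz bound separates the
        two leg images by the amount that the fork inequality requires.\<close>
      moreover have "2 * (c / (2 * C)) * M \<le> c * s"
        using M_le \<open>0 < c\<close> \<open>0 < C\<close> by (simp add: field_simps)
      ultimately have "2 * (c / (2 * C)) * M \<le> N ((f (t j) - f x) - (f (t i) - f x))" by simp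
      from uniformly_convex_fork[OF N \<open>0 < M\<close> uc xy t(4)[OF ij(2)] t(4)[OF ij(1)] this]
      have "N (f (t j) - f y) \<le> 2 * q * M \<or> N (f (t i) - f y) \<le> 2 * q * M" by simp
      then show ?thesis using t ij by blast
    qed
    then have "\<forall>i<3. \<exists>w. w \<in> A \<and> gromov_product d (z i) y w \<le> R + \<delta> \<and> s - R \<le> d (z i) w \<and>
        N (f w - f y) \<le> 2 * q * M"
      using z by blast
    then obtain w where w: "\<And>i. i < 3 \<Longrightarrow> w i \<in> A"
      "\<And>i. i < 3 \<Longrightarrow> gromov_product d (z i) y (w i) \<le> R + \<delta>"
      "\<And>i. i < 3 \<Longrightarrow> s - R \<le> d (z i) (w i)"
      "\<And>i. i < 3 \<Longrightarrow> N (f (w i) - f y) \<le> 2 * q * M"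
      by metis
    \<comment> \<open>These identities turn a small product at the joint \<open>z i\<close> into a
      long leg to \<open>w i\<close> and into a large product of \<open>z i\<close> and
      \<open>w i\<close> at \<open>y\<close>.\<close>
    have prods: "gromov_product d y (z i) (w i) = d y (z i) - gromov_product d (z i) y (w i)"
      "d y (w i) = d y (z i) + d (z i) (w i) - 2 * gromov_product d (z i) y (w i)"
      "gromov_product d y (w i) (z i) = gromov_product d y (z i) (w i)" if "i < 3" for i
      using sym[OF y z(1)[OF that]] sym[OF y w(1)[OF that]] sym[OF z(1)[OF that] w(1)[OF that]]
      by (simp_all add: gromov_product_def field_simps)
    have "tripod d R' y w"
      unfolding tripod_def
    proof (intro allI impI)
      fix i j :: nat assume ij: "i < 3" "j < 3" "i \<noteq> j"
      \<comment> \<open>Seen from \<open>y\<close>, \<open>w i\<close> and \<open>z i\<close> share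
        a long initial segment. Replacing \<open>z j\<close> by \<open>w j\<close> and
        \<open>z i\<close> by \<open>w i\<close> in the product therefore costs only
        \<open>\<delta>\<close> each time.\<close>
      have "gromov_product d y (z i) (z j) \<le> R" using z(2) ij by (simp add: tripod_def)
      moreover have "gromov_product d y (z i) (z j)
          \<ge> min (gromov_product d y (z i) (w i)) (gromov_product d y (w i) (z j)) - \<delta>"
        "gromov_product d y (w i) (z j)
          \<ge> min (gromov_product d y (w i) (w j)) (gromov_product d y (w j) (z j)) - \<delta>"
        using hyp y z(1) w(1) ij by (simp_all add: delta_hyperbolic_def)
      moreover have "gromov_product d y (z i) (w i) \<ge> s - 2 * R - \<delta>"
        "gromov_product d y (w j) (z j) \<ge> s - 2 * R - \<delta>"
        using prods z(3) w(2) ij by (smt (verit))+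
      ultimately have "gromov_product d y (w i) (w j) \<le> R + 2 * \<delta>"
        using s_large \<open>0 < s\<close> \<open>0 \<le> \<delta>\<close> R by linarith
      then show "gromov_product d y (w i) (w j) \<le> R'" using \<open>0 \<le> \<delta>\<close> R by (simp add: R'_def)
    qed
    moreover have "2 * s - R' \<le> d y (w i)" if "i < 3" for i
      using prods(2)[OF that] z(3)[OF that] w(2,3)[OF that] by (simp add: R'_def)
    moreover have "w ` {..<3} \<subseteq> A" using w by auto
    moreover have eqs: "2 ^ Suc k * real n = 2 * s" "q ^ Suc k * C * (2 * s) = 2 * q * M"
      by (simp_all add: s_def M_def)
    ultimately show ?thesis unfolding eqs using w(4) by (intro exI[of _ w]) simp
  qed
  then show ?case by (intro exI[of _ R'] exI[of _ n1]) simp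
qed

text \<open>Choose \<open>k\<close> so large that the contraction \<open>q ^ k * C\<close> is below
  \<open>c / 2\<close>. At a scale where the loss \<open>R\<close> is at most half of a leg, that
  leg violates the lower bound.\<close>

lemma branching_not_bilipschitz:
  fixes N :: "'v::real_vector \<Rightarrow> real"
  assumes hyp: "delta_hyperbolic A d \<delta>" and "0 \<le> \<delta>" "A \<noteq> {}"
    and sym: "\<And>u v. u \<in> A \<Longrightarrow> v \<in> A \<Longrightarrow> d u v = d v u"
    and branch: "\<And>y n. y \<in> A \<Longrightarrow> \<exists>z. z ` {..<3} \<subseteq> A \<and> tripod d R0 y z \<and> (\<forall>i<3. d y (z i) = real n)"
    and N: "is_norm N" "uniformly_convex_norm N"
    and "0 < c" "0 < C"
    and bounds: "\<And>u v. u \<in> A \<Longrightarrow> v \<in> A \<Longrightarrow>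
      c * d u v \<le> N (f v - f u) \<and> N (f v - f u) \<le> C * d u v"
  shows False
proof -
  have "c / (2 * C) > 0" using \<open>0 < c\<close> \<open>0 < C\<close> by simp
  with N(2) obtain \<eta> where \<eta>: "\<eta> > 0"
    "\<And>x y. N x \<le> 1 \<Longrightarrow> N y \<le> 1 \<Longrightarrow> N (x - y) \<ge> c / (2 * C) \<Longrightarrow> N ((1/2) *\<^sub>R (x + y)) \<le> 1 - \<eta>"
    unfolding uniformly_convex_norm_def by meson
  \<comment> \<open>The maximum with \<open>1/2\<close> keeps \<open>q\<close> positive when
    \<open>\<eta>\<close> is at least 1.\<close>
  define q where "q = max (1/2) (1 - \<eta>)"
  have q: "0 < q" "q < 1" using \<eta> by (auto simp: q_def)
  have uc: "N ((1/2) *\<^sub>R (x + y)) \<le> q" if "N x \<le> 1" "N y \<le> 1" "N (x - y) \<ge> c / (2 * C)" for x y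
    using \<eta>(2)[OF that] by (simp add: q_def)
  obtain k where k: "q ^ k < c / (2 * C)"
    using real_arch_pow_inv[OF \<open>c / (2 * C) > 0\<close> \<open>q < 1\<close>] by blast
  obtain y where y: "y \<in> A" using \<open>A \<noteq> {}\<close> by blast
  obtain R n0 where Rn0: "\<forall>n\<ge>n0. \<forall>y\<in>A. \<exists>z. z ` {..<3} \<subseteq> A \<and> tripod d R y z \<and>
    (\<forall>i<3. 2 ^ k * real n - R \<le> d y (z i) \<and> N (f (z i) - f y) \<le> q ^ k * C * (2 ^ k * real n))"
    using branching_doubling[OF hyp \<open>0 \<le> \<delta>\<close> sym branch N(1) \<open>0 < c\<close> \<open>0 < C\<close> \<open>0 < q\<close> less_imp_le[OF q(2)] bounds uc, of k]
    by blast
  define n where "n = max (max n0 1) (nat \<lceil>2 * R\<rceil>)"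
  define s where "s = 2 ^ k * real n"
  have "n0 \<le> n" by (simp add: n_def)
  with Rn0 y obtain z where "z ` {..<3} \<subseteq> A"
    "\<forall>i<(3::nat). s - R \<le> d y (z i) \<and> N (f (z i) - f y) \<le> q ^ k * C * s"
    unfolding s_def by meson
  then have z: "z 0 \<in> A" "s - R \<le> d y (z 0)" "N (f (z 0) - f y) \<le> q ^ k * C * s" by auto
  have "2 * R \<le> real n" "0 < real n" unfolding n_def by linarith+
  moreover have "real n \<le> s" by (simp add: s_def mult_left_le_one_le mult_le_cancel_right1)
  ultimately have s: "s / 2 \<le> s - R" "0 < s" by auto
  have "c * (s / 2) \<le> c * d y (z 0)" using s z \<open>0 < c\<close> by simp
  also have "\<dots> \<le> q ^ k * C * s" using bounds[OF y z(1)] z(3) by simp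
  also have "\<dots> < c / (2 * C) * C * s" using k \<open>0 < C\<close> \<open>0 < s\<close> by (intro mult_strict_right_mono)
  also have "\<dots> = c * (s / 2)" using \<open>0 < C\<close> by simp
  finally show False by simp
qed

section \<open>Hyperbolic word metrics\<close>

text \<open>Expanding the products cancels the common distances to \<open>w\<close>. The resulting
  inequality between the three pairings of four points suits linear arithmetic.\<close>

lemma hyperbolic_four_point:
  assumes "delta_hyperbolic A d \<delta>" "x \<in> A" "y \<in> A" "z \<in> A" "w \<in> A"
  shows "d x z + d y w \<le> max (d x y + d z w) (d y z + d x w) + 2 * \<delta>"
proof -
  have "gromov_product d w x z \<ge> min (gromov_product d w x y) (gromov_product d w y z) - \<delta>"
    using assms by (simp add: delta_hyperbolic_def)
  then have "2 * gromov_product d w x z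
      \<ge> min (2 * gromov_product d w x y) (2 * gromov_product d w y z) - 2 * \<delta>"
    by linarith
  moreover have "2 * gromov_product d w u v = d u w + d v w - d u v" for u v
    by (simp add: gromov_product_def)
  ultimately show ?thesis by simp
qed

context finitely_generated
begin

lemma delta_nonneg:
  assumes "delta_hyperbolic (carrier G) d \<delta>"
  shows "0 \<le> \<delta>"
  using hyperbolic_four_point[OF assms one_closed one_closed one_closed one_closed]
  by (simp add: d_self)

section \<open>Thin triangles: an infinite cyclic subgroup of finite index\<close>

lemma d_inv: "g \<in> carrier G \<Longrightarrow> d (inv g) \<one> = d \<one> g"
  by (simp add: word_metric_def)

lemma d_inv_mult:
  assumes "g \<in> carrier G" "x \<in> carrier G" "y \<in> carrier G"
  shows "d (inv g \<otimes> x) y = d x (g \<otimes> y)"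
  using d_translate[of g "inv g \<otimes> x" y] assms by (simp add: mult_inv_cancel)

text \<open>An element that is not a coarse translation coarsely reverses the line. If \<open>a\<close>, \<open>b\<close> and
  \<open>inv a \<otimes> b\<close> all did so, with \<open>a\<close> the midpoint of a geodesic from \<open>\<one>\<close> to \<open>b\<close>, then
  \<open>\<one>\<close>, \<open>a\<close>, \<open>b\<close>, \<open>inv a \<otimes> b\<close> would be the vertices of a large square, which the four-point
  condition excludes.\<close>

lemma coarse_translation_exists:
  assumes hyp: "delta_hyperbolic (carrier G) d \<delta>" and inf: "infinite (carrier G)"
    and thin: "\<And>x y z. x \<in> carrier G \<Longrightarrow> y \<in> carrier G \<Longrightarrow> z \<in> carrier G \<Longrightarrow>
      d x y + d y z \<le> d x z + e \<or> d y x + d x z \<le> d y z + e \<or> d x z + d z y \<le> d x y + e"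
  obtains g where "g \<in> carrier G" "K \<le> d \<one> g" "2 * d \<one> g \<le> d (inv g) g + e"
proof -
  define N where "N = nat \<lceil>max K (3 * \<bar>e\<bar> + 2 * \<delta>)\<rceil> + 1"
  have N: "K \<le> real N" "3 * \<bar>e\<bar> + 2 * \<delta> < real N" "0 < real N"
    unfolding N_def by linarith+
  \<comment> \<open>The triangle \<open>inv g\<close>, \<one>, \<open>g\<close> has two sides of
    length \<open>d \<one> g\<close>. Either \<one> is coarsely between the other vertices, or the
    third side is at most \<open>e\<close>.\<close>
  have flip: "2 * d \<one> g \<le> d (inv g) g + e \<or> d (inv g) g \<le> e" if "g \<in> carrier G" for g
    using thin[of "inv g" \<one> g] d_inv[of g] d_sym[of "inv g" \<one>] d_sym[of g \<one>] d_sym[of g "inv g"] that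
    by fastforce
  obtain b where b: "b \<in> carrier G" "len b = 2 * N"
    by (rule long_element[OF inf])
  then have "real N \<le> d \<one> b" by (simp add: d_one)
  then obtain a where a: "a \<in> carrier G" "d \<one> a = N" "d a b = d \<one> b - N"
    by (rule geodesic_point[OF one_closed b(1)])
  define u where "u = inv a \<otimes> b"
  have u: "u \<in> carrier G" using a b by (simp add: u_def)
  have db: "d \<one> b = 2 * real N" using b by (simp add: d_one)
  have du: "d \<one> u = N" using a db d_inv_mult[of a b \<one>] d_sym[of u \<one>] d_sym[of a b] u b
    by (simp add: u_def)
  show thesis
  proof (cases "d (inv a) a \<le> e \<and> d (inv b) b \<le> e \<and> d (inv u) u \<le> e")
    case False
    then show thesis using that[of a] that[of b] that[of u] flip[of a] flip[of b] flip[of u]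
        a b u db du N by auto
  next
    case True
    \<comment> \<open>In the square \<one>, \<open>a\<close>, \<open>b\<close>, \<open>u\<close> the
      sides are \<open>N\<close>, except that \<open>d b u\<close> is only at most
      \<open>N + 2 * e\<close>; the diagonals are \<open>2 * N\<close> and at least
      \<open>2 * N - e\<close>. The four-point condition would bound \<open>2 * N\<close> by
      \<open>3 * \<bar>e\<bar> + 2 * \<delta>\<close>.\<close>
    have "inv u = inv b \<otimes> a" using a b by (simp add: u_def inv_mult_group)
    then have "d (inv u) (inv b) = d \<one> a"
      using d_inv_mult[of b a "inv b"] a b d_sym[of a \<one>] by simp
    moreover have "d u (inv a) = d \<one> b"
      using d_inv_mult[of a b "inv a"] a b d_sym[of b \<one>] by (simp add: u_def)
    moreover have "d u (inv a) \<le> d u a + d a (inv a)" "d a (inv a) = d (inv a) a"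
      using d_triangle[of u a "inv a"] d_sym[of a "inv a"] u a by simp_all
    moreover have "d b u \<le> d b (inv b) + d (inv b) (inv u) + d (inv u) u"
      "d b (inv b) = d (inv b) b" "d (inv b) (inv u) = d (inv u) (inv b)" "d a u = d u a"
      using d_triangle[of b "inv b" u] d_triangle[of "inv b" "inv u" u] d_sym[of b "inv b"]
        d_sym[of "inv b" "inv u"] d_sym[of a u] u a b by simp_all
    moreover have "d \<one> b + d a u \<le> max (d \<one> a + d b u) (d a b + d \<one> u) + 2 * \<delta>"
      using hyperbolic_four_point[OF hyp, of \<one> a b u] a b u by simp
    ultimately have False using True N a db du by linarith
    then show thesis ..
  qed
qed

text \<open>Apply the four-point condition to \<one> and three consecutive powers. If the distance
  from \<one> grew at the last step, the first alternative would force \<open>d \<one> g\<close>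
  below \<open>e + 2 * \<delta>\<close>; the second makes the distance grow again.\<close>

lemma coarse_translation_infinite_order:
  assumes hyp: "delta_hyperbolic (carrier G) d \<delta>"
    and g: "g \<in> carrier G" "2 * d \<one> g \<le> d (inv g) g + e" "e + 2 * \<delta> < d \<one> g"
  shows "strict_mono (\<lambda>n. d \<one> (g [^] (n::nat)))"
proof -
  have pow: "g [^] (n::nat) \<in> carrier G" for n using g by simp
  have next1: "d (g [^] n) (g [^] Suc n) = d \<one> g" for n
    using d_translate[of "g [^] n" \<one> g] g by simp
  have next2: "d (g [^] n) (g [^] Suc (Suc n)) = d (inv g) g" for n
    using d_translate[of "g [^] n" \<one> "g \<otimes> g"] d_inv_mult[of g \<one> g] g by (simp add: m_assoc)
  have "d \<one> (g [^] n) < d \<one> (g [^] Suc n)" for n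
  proof (induction n)
    case 0
    have "0 < d \<one> g"
      using g d_triangle[of "inv g" \<one> g] d_inv[of g] delta_nonneg[OF hyp] by simp
    then show ?case using g d_self[of \<one>] by simp
  next
    case (Suc n)
    have "d \<one> (g [^] Suc n) + d (g [^] n) (g [^] Suc (Suc n))
        \<le> max (d \<one> (g [^] n) + d (g [^] Suc n) (g [^] Suc (Suc n)))
            (d (g [^] n) (g [^] Suc n) + d \<one> (g [^] Suc (Suc n))) + 2 * \<delta>"
      by (rule hyperbolic_four_point[OF hyp one_closed pow pow pow])
    then show ?case using Suc.IH g(2,3) unfolding next1 next2 by linarith
  qed
  then show ?thesis by (rule strict_monoI_Suc)
qed

text \<open>Here \<one> is at least as close to \<open>x\<close> as its neighbours \<open>g\<close>
  and \<open>inv g\<close> on the orbit. If \<open>x\<close> were far away, thinness would put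
  \<one> coarsely between \<open>x\<close> and each neighbour, and the triangle
  \<open>inv g\<close>, \<open>g\<close>, \<open>x\<close> would be fat.\<close>

lemma coarse_translation_cocompact:
  assumes thin: "\<And>x y z. x \<in> carrier G \<Longrightarrow> y \<in> carrier G \<Longrightarrow> z \<in> carrier G \<Longrightarrow>
      d x y + d y z \<le> d x z + e \<or> d y x + d x z \<le> d y z + e \<or> d x z + d z y \<le> d x y + e"
    and g: "g \<in> carrier G" "2 * d \<one> g \<le> d (inv g) g + e" "2 * \<bar>e\<bar> < d \<one> g"
    and x: "x \<in> carrier G" "d \<one> x \<le> d g x" "d \<one> x \<le> d (inv g) x"
  shows "d \<one> x \<le> 2 * d \<one> g"
proof (rule ccontr)
  assume far: "\<not> ?thesis"
  have syms: "d g \<one> = d \<one> g" "d \<one> (inv g) = d \<one> g" "d (inv g) \<one> = d \<one> g" "d x \<one> = d \<one> x"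
    "d x g = d g x" "d x (inv g) = d (inv g) x" "d g (inv g) = d (inv g) g"
    using d_sym g x d_inv by simp_all
  have "d \<one> g + d \<one> x \<le> d g x + e"
    using thin[of g \<one> x] g x far unfolding syms by fastforce
  moreover have "d \<one> g + d \<one> x \<le> d (inv g) x + e"
    using thin[of "inv g" \<one> x] g x far unfolding syms by fastforce
  moreover have "d (inv g) x \<le> d \<one> g + d \<one> x" "d g x \<le> d \<one> g + d \<one> x" "d (inv g) g \<le> 2 * d \<one> g"
    using d_triangle[of "inv g" \<one> x] d_triangle[of g \<one> x] d_triangle[of "inv g" \<one> g] g x syms by simp_all
  moreover have "d (inv g) g + d g x \<le> d (inv g) x + e \<or> d g (inv g) + d (inv g) x \<le> d g x + e \<or>
      d (inv g) x + d x g \<le> d (inv g) g + e"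
    using thin[of "inv g" g x] g x by simp
  ultimately show False using g far unfolding syms by linarith
qed

lemma powers_iso_Z:
  assumes g: "g \<in> carrier G" and inj: "inj (\<lambda>n::nat. g [^] n)"
  shows "G\<lparr>carrier := range (\<lambda>n::int. g [^] n)\<rparr> \<cong> integer_group"
proof -
  let ?H = "range (\<lambda>n::int. g [^] n)"
  have "\<forall>m n::nat. g [^] m = g [^] n \<longrightarrow> m = n" using inj by (simp add: inj_def)
  then have "\<forall>i j::int. g [^] i = g [^] j \<longrightarrow> i = j"
    using infinite_cyclic_subgroup[OF g] infinite_cyclic_subgroup_int[OF g] by simp
  then have "bij_betw (\<lambda>n::int. g [^] n) UNIV ?H"
    by (simp add: bij_betw_def inj_on_def)
  then have "(\<lambda>n::int. g [^] n) \<in> iso integer_group (G\<lparr>carrier := ?H\<rparr>)"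
    using g by (auto simp: iso_def hom_def int_pow_mult)
  then have "integer_group \<cong> G\<lparr>carrier := ?H\<rparr>" by (rule is_isoI)
  then show ?thesis by (rule group.iso_sym[OF group_integer_group])
qed

lemma powers_finite_index:
  assumes g: "g \<in> carrier G"
    and near: "\<And>x. x \<in> carrier G \<Longrightarrow> d \<one> x \<le> d g x \<Longrightarrow> d \<one> x \<le> d (inv g) x \<Longrightarrow> d \<one> x \<le> K"
  shows "finite (rcosets (range (\<lambda>n::int. g [^] n)))"
proof -
  define H where "H = range (\<lambda>n::int. g [^] n)"
  have H: "subgroup H G" unfolding H_def by (rule subgroup_of_powers[OF g])
  have "rcosets H \<subseteq> (\<lambda>s. H #> s) ` {s \<in> carrier G. len s \<le> nat \<lfloor>K\<rfloor>}"
  proof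
    fix c assume "c \<in> rcosets H"
    then obtain x where x: "x \<in> carrier G" "c = H #> x" by (auto simp: RCOSETS_def)
    \<comment> \<open>A shortest representative of the form \<open>g [^] k \<otimes> x\<close> is no
      farther from \<one> than from \<open>g\<close> and \<open>inv g\<close>, so
      \<open>near\<close> places it in a finite ball.\<close>
    obtain k :: int where k: "\<And>j :: int. len (g [^] k \<otimes> x) \<le> len (g [^] j \<otimes> x)"
      using ex_has_least_nat[of "\<lambda>_. True" _ "\<lambda>j::int. len (g [^] j \<otimes> x)"] by blast
    define s where "s = g [^] k \<otimes> x"
    have s: "s \<in> carrier G" using g x by (simp add: s_def)
    have "inv g \<otimes> s = g [^] (- 1 + k) \<otimes> x" "g \<otimes> s = g [^] (1 + k) \<otimes> x"
      unfolding s_def using g x int_pow_mult[of g "- 1" k] int_pow_mult[of g 1 k]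
      by (simp_all only: int_pow_neg int_pow_1 int_pow_closed inv_closed m_assoc)
    with k have "len s \<le> len (inv g \<otimes> s)" "len s \<le> len (g \<otimes> s)" by (simp_all add: s_def)
    then have "d \<one> s \<le> K" using near[OF s] s g by (simp add: word_metric_def)
    then have "len s \<le> nat \<lfloor>K\<rfloor>" using s by (simp add: d_one le_nat_floor)
    moreover have "s \<in> H #> x" unfolding s_def r_coset_def H_def by auto
    then have "c = H #> s" using repr_independence[OF _ x(1) H] x(2) by simp
    ultimately show "c \<in> (\<lambda>s. H #> s) ` {s \<in> carrier G. len s \<le> nat \<lfloor>K\<rfloor>}" using s by auto
  qed
  then show ?thesis using finite_ball finite_surj unfolding H_def by metis
qed

lemma thin_triangles_imp_virtually_Z:
  assumes hyp: "delta_hyperbolic (carrier G) d \<delta>" and inf: "infinite (carrier G)"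
    and thin: "\<And>x y z. x \<in> carrier G \<Longrightarrow> y \<in> carrier G \<Longrightarrow> z \<in> carrier G \<Longrightarrow>
      d x y + d y z \<le> d x z + e \<or> d y x + d x z \<le> d y z + e \<or> d x z + d z y \<le> d x y + e"
  shows "has_finite_index_subgroup_iso_Z G"
proof -
  \<comment> \<open>This lower bound on \<open>d \<one> g\<close> exceeds both thresholds,
    \<open>e + 2 * \<delta>\<close> for infinite order and \<open>2 * \<bar>e\<bar>\<close> for
    finite index.\<close>
  obtain g where g: "g \<in> carrier G" "2 * \<bar>e\<bar> + 2 * \<delta> + 1 \<le> d \<one> g" "2 * d \<one> g \<le> d (inv g) g + e"
    by (rule coarse_translation_exists[OF hyp inf thin])
  have "strict_mono (\<lambda>n. d \<one> (g [^] (n::nat)))"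
    using g by (intro coarse_translation_infinite_order[OF hyp]) auto
  then have "inj (\<lambda>n. d \<one> (g [^] (n::nat)))" by (rule strict_mono_imp_inj_on)
  then have inj: "inj (\<lambda>n::nat. g [^] n)" by (auto simp: inj_def)
  have "2 * \<bar>e\<bar> < d \<one> g" using g delta_nonneg[OF hyp] by simp
  then have "d \<one> x \<le> 2 * d \<one> g" if "x \<in> carrier G" "d \<one> x \<le> d g x" "d \<one> x \<le> d (inv g) x" for x
    using coarse_translation_cocompact[OF thin g(1,3) _ that] by blast
  from powers_finite_index[OF g(1) this] powers_iso_Z[OF g(1) inj] subgroup_of_powers[OF g(1)]
  show ?thesis unfolding has_finite_index_subgroup_iso_Z_def by blast
qed

section \<open>Fat triangles: tripods centred at every point\<close>

lemma fat_triangle_center: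
  assumes hyp: "delta_hyperbolic (carrier G) d \<delta>"
    and x: "x \<in> carrier G" "y \<in> carrier G" "z \<in> carrier G"
    and fat: "real n + 1 \<le> gromov_product d x y z" "real n + 1 \<le> gromov_product d y x z"
      "real n + 1 \<le> gromov_product d z x y"
  obtains p where "p \<in> carrier G" "real n \<le> d p x" "real n \<le> d p y" "real n \<le> d p z"
    "gromov_product d p x y \<le> \<delta> + 1" "gromov_product d p x z \<le> \<delta> + 1"
    "gromov_product d p y z \<le> \<delta> + 1"
proof -
  \<comment> \<open>The centre lies on a geodesic from \<open>x\<close> to \<open>y\<close>, where
    in a tree the way to \<open>z\<close> branches off. Rounding that distance down to an integer
    costs the 1 in \<open>\<delta> + 1\<close>.\<close>
  define m where "m = nat \<lfloor>gromov_product d x y z\<rfloor>"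
  have m: "real m \<le> gromov_product d x y z" "gromov_product d x y z < real m + 1"
    using fat(1) unfolding m_def by linarith+
  have syms: "d y x = d x y" "d z x = d x z" "d z y = d y z" using d_sym x by simp_all
  have "gromov_product d x y z \<le> d x y"
    using d_triangle[of x y z] x by (simp add: gromov_product_def syms)
  with m have "real m \<le> d x y" by simp
  then obtain p where p: "p \<in> carrier G" "d x p = m" "d p y = d x y - m"
    by (rule geodesic_point[OF x(1,2)])
  have psyms: "d p x = d x p" "d y p = d p y" "d z p = d p z" using d_sym x p by simp_all
  have "d z p + d x y \<le> max (d z x + d p y) (d x p + d z y) + 2 * \<delta>"
    using hyperbolic_four_point[OF hyp, of z x p y] x p by simp
  moreover have "d x z \<le> d x p + d p z" using d_triangle x p by blast
  ultimately show thesis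
    using that[OF p(1)] m fat p(2,3) delta_nonneg[OF hyp]
    unfolding gromov_product_def syms psyms by argo
qed

text \<open>Left translation by \<open>y \<otimes> inv p\<close> carries the centre \<open>p\<close>
  of a sufficiently fat triangle to \<open>y\<close>. Its legs are then cut at distance
  \<open>n\<close>; by the triangle inequality, cutting does not increase the products at
  \<open>y\<close>.\<close>

lemma fat_triangles_imp_branching:
  assumes hyp: "delta_hyperbolic (carrier G) d \<delta>"
    and fat: "\<And>K. \<exists>x\<in>carrier G. \<exists>y\<in>carrier G. \<exists>z\<in>carrier G.
      K \<le> gromov_product d x y z \<and> K \<le> gromov_product d y x z \<and> K \<le> gromov_product d z x y"
    and y: "y \<in> carrier G"
  shows "\<exists>z. z ` {..<3} \<subseteq> carrier G \<and> tripod d (\<delta> + 1) y z \<and> (\<forall>i<3. d y (z i) = real n)"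
proof -
  obtain a b c where abc: "a \<in> carrier G" "b \<in> carrier G" "c \<in> carrier G"
    "real n + 1 \<le> gromov_product d a b c" "real n + 1 \<le> gromov_product d b a c"
    "real n + 1 \<le> gromov_product d c a b"
    using fat[of "real n + 1"] by blast
  obtain p where p: "p \<in> carrier G" "real n \<le> d p a" "real n \<le> d p b" "real n \<le> d p c"
    "gromov_product d p a b \<le> \<delta> + 1" "gromov_product d p a c \<le> \<delta> + 1"
    "gromov_product d p b c \<le> \<delta> + 1"
    by (rule fat_triangle_center[OF hyp abc])
  define x where "x i = (if i = (0::nat) then a else if i = 1 then b else c)" for i
  have x: "x i \<in> carrier G" "real n \<le> d p (x i)" for i
    using abc p by (simp_all add: x_def)
  have "gromov_product d p v u = gromov_product d p u v" if "u \<in> carrier G" "v \<in> carrier G" for u v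
    using d_sym[OF that] by (simp add: gromov_product_def)
  then have prod: "gromov_product d p (x i) (x j) \<le> \<delta> + 1" if "i < 3" "j < 3" "i \<noteq> j" for i j
    using that p abc by (auto simp: x_def)
  define h where "h = y \<otimes> inv p"
  have h: "h \<in> carrier G" "h \<otimes> p = y" using y p by (simp_all add: h_def m_assoc)
  have dist: "d y (h \<otimes> x i) = d p (x i)" "d (h \<otimes> x i) (h \<otimes> x j) = d (x i) (x j)" for i j
    using d_translate[OF h(1) p(1) x(1)[of i]] d_translate[OF h(1) x(1) x(1)] h(2) by simp_all
  have "\<exists>z. z \<in> carrier G \<and> d y z = n \<and> d z (h \<otimes> x i) = d p (x i) - n" for i
  proof -
    have "h \<otimes> x i \<in> carrier G" "real n \<le> d y (h \<otimes> x i)" using h x dist by simp_all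
    then obtain z where "z \<in> carrier G" "d y z = n" "d z (h \<otimes> x i) = d y (h \<otimes> x i) - n"
      by (rule geodesic_point[OF y])
    then show ?thesis using dist by auto
  qed
  then obtain z where z: "\<And>i. z i \<in> carrier G" "\<And>i. d y (z i) = n"
    "\<And>i. d (z i) (h \<otimes> x i) = d p (x i) - n" by metis
  have "tripod d (\<delta> + 1) y z"
    unfolding tripod_def
  proof (intro allI impI)
    fix i j :: nat assume ij: "i < 3" "j < 3" "i \<noteq> j"
    have hx: "h \<otimes> x k \<in> carrier G" for k using h x by simp
    have "d (h \<otimes> x i) (h \<otimes> x j) \<le> d (z i) (h \<otimes> x i) + d (z i) (z j) + d (z j) (h \<otimes> x j)"
      using d_triangle[OF hx[of i] z(1)[of i] hx[of j]] d_triangle[OF z(1)[of i] z(1)[of j] hx[of j]]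
        d_sym[OF hx[of i] z(1)[of i]] by simp
    moreover have "d (x i) p = d p (x i)" "d (x j) p = d p (x j)" "d (z i) y = n" "d (z j) y = n"
      using d_sym x p z y by simp_all
    ultimately show "gromov_product d y (z i) (z j) \<le> \<delta> + 1"
      using prod[OF ij] dist(2)[of i j] z(3)[of i] z(3)[of j] by (simp add: gromov_product_def)
  qed
  then show ?thesis using z by (intro exI[of _ z]) auto
qed

end

section \<open>Transfer of the embedding and the dichotomy of triangles\<close>

theorem theoremT:
  fixes G :: "('a, 'b) monoid_scheme" and S :: "'a set" and f :: "'a \<Rightarrow> 'v::banach"
  assumes "group G"
    and "infinite (carrier G)"
    and "finitely_generated_group G"
    and "word_hyperbolic G"
    and "\<not> has_finite_index_subgroup_iso_Z G"
    and "finite_generating_set G S"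
    and "bilipschitz_embedding (carrier G) (word_metric G S) f"
  shows "\<not> superreflexive TYPE('v)"
proof
  assume "superreflexive TYPE('v)"
  then obtain N :: "'v \<Rightarrow> real" where N: "is_norm N" "uniformly_convex_norm N"
    and "equivalent_norm N"
    unfolding superreflexive_def equivalent_norm_def by blast
  then obtain c1 C1 where N_equiv: "0 < c1" "0 < C1" "\<And>x. c1 * norm x \<le> N x" "\<And>x. N x \<le> C1 * norm x"
    unfolding equivalent_norm_def by blast
  obtain c2 C2 where f: "0 < c2" "c2 \<le> C2"
    "\<And>u v. u \<in> carrier G \<Longrightarrow> v \<in> carrier G \<Longrightarrow> c2 * word_metric G S u v \<le> norm (f u - f v)"
    "\<And>u v. u \<in> carrier G \<Longrightarrow> v \<in> carrier G \<Longrightarrow> norm (f u - f v) \<le> C2 * word_metric G S u v"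
    using assms(7) unfolding bilipschitz_embedding_def by blast
  obtain T \<delta> where T: "finite_generating_set G T" and hyp: "delta_hyperbolic (carrier G) (word_metric G T) \<delta>"
    using assms(4) unfolding word_hyperbolic_def by blast
  interpret group G by fact
  interpret finitely_generated G T by unfold_locales fact
  obtain A where A: "A > 0" "\<And>g. g \<in> carrier G \<Longrightarrow> word_length G S g \<le> A * word_length G T g"
    using word_length_le_word_length[OF assms(1,6) T] by blast
  obtain B where B: "B > 0" "\<And>g. g \<in> carrier G \<Longrightarrow> word_length G T g \<le> B * word_length G S g"
    using word_length_le_word_length[OF assms(1) T assms(6)] by blast
  \<comment> \<open>The embedding is re-expressed with the hyperbolic metric of \<open>T\<close> and
    the convex norm \<open>N\<close>: \<open>B\<close> enters the lower constant, \<open>A\<close>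
    the upper one.\<close>
  have bounds: "c1 * c2 / B * d u v \<le> N (f v - f u) \<and> N (f v - f u) \<le> C1 * C2 * A * d u v"
    if uv: "u \<in> carrier G" "v \<in> carrier G" for u v
  proof
    have "d u v \<le> B * word_metric G S u v" "word_metric G S u v \<le> A * d u v"
      using A(2)[of "inv\<^bsub>G\<^esub> u \<otimes>\<^bsub>G\<^esub> v"] B(2)[of "inv\<^bsub>G\<^esub> u \<otimes>\<^bsub>G\<^esub> v"] uv
      by (simp_all add: word_metric_def flip: of_nat_mult)
    then have dB: "d u v / B \<le> word_metric G S u v" and dA: "word_metric G S u v \<le> A * d u v"
      using B(1) by (simp_all add: field_simps)
    have "c1 * c2 / B * d u v = c1 * (c2 * (d u v / B))" by simp
    also have "\<dots> \<le> c1 * (c2 * word_metric G S u v)"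
      using dB f(1) N_equiv(1) by (intro mult_left_mono) auto
    also have "\<dots> \<le> c1 * norm (f v - f u)"
      using f(3)[OF uv] N_equiv(1) by (simp add: norm_minus_commute)
    also have "\<dots> \<le> N (f v - f u)" by (rule N_equiv)
    finally show "c1 * c2 / B * d u v \<le> N (f v - f u)" .
    have "N (f v - f u) \<le> C1 * norm (f v - f u)" by (rule N_equiv)
    also have "\<dots> \<le> C1 * (C2 * word_metric G S u v)"
      using f(4)[OF uv] N_equiv(2) by (simp add: norm_minus_commute)
    also have "\<dots> \<le> C1 * (C2 * (A * d u v))"
      using dA f(1,2) N_equiv(2) by (intro mult_left_mono) auto
    finally show "N (f v - f u) \<le> C1 * C2 * A * d u v" by (simp add: mult.assoc)
  qed
  show False
  proof (cases "\<forall>K. \<exists>x\<in>carrier G. \<exists>y\<in>carrier G. \<exists>z\<in>carrier G.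
      K \<le> gromov_product d x y z \<and> K \<le> gromov_product d y x z \<and> K \<le> gromov_product d z x y")
    case True
    have pos: "0 < c1 * c2 / B" "0 < C1 * C2 * A" using f N_equiv A(1) B(1) by simp_all
    have ne: "carrier G \<noteq> {}" by auto
    show False
      using branching_not_bilipschitz[OF hyp delta_nonneg[OF hyp] ne d_sym
          fat_triangles_imp_branching[OF hyp True[rule_format]] N pos bounds] .
  next
    case False
    then obtain K where K: "\<And>x y z. x \<in> carrier G \<Longrightarrow> y \<in> carrier G \<Longrightarrow> z \<in> carrier G \<Longrightarrow>
      gromov_product d x y z < K \<or> gromov_product d y x z < K \<or> gromov_product d z x y < K"
      by (meson not_le)
    \<comment> \<open>The defect \<open>d x y + d y z - d x z\<close> is twice the product at
      \<open>y\<close>, hence the constant \<open>2 * K\<close>.\<close>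
    have "d x y + d y z \<le> d x z + 2 * K \<or> d y x + d x z \<le> d y z + 2 * K \<or> d x z + d z y \<le> d x y + 2 * K"
      if "x \<in> carrier G" "y \<in> carrier G" "z \<in> carrier G" for x y z
      using K[OF that] d_sym[OF that(1,2)] d_sym[OF that(2,3)] d_sym[OF that(1,3)]
      unfolding gromov_product_def by argo
    then show False using thin_triangles_imp_virtually_Z[OF hyp assms(2)] assms(5) by blast
  qed
qed

end
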